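(* Let $\Omega\subset\mathbb{R}^d$ be a bounded Lipschitz domain, $s\in(0,1)$ and $\gamma\ge s$. There exists a constant $C>0$ such that, for all $v\in\mathbb{V}$, $$\|v\|_{L^2_\gamma(\mathbb{R}^d)}\le C\|v\|_{\mathbb{V}}.$$ Thus, the embedding $\mathbb{V}\subset L^2_\gamma(\mathbb{R}^d)$ is continuous for all $\gamma\ge s$.
   Context: $\Omega^c=\mathbb{R}^d\setminus\overline\Omega$, and $C_{d,s}=\frac{2^{2s}s\,\Gamma(s+d/2)}{\pi^{d/2}\Gamma(1-s)}$. $|v|_{\mathbb{X}}=\Big(\frac{C_{d,s}}{2}\iint_{(\mathbb{R}^d\times\mathbb{R}^d)\setminus(\Omega^c\times\Omega^c)}\frac{|v(x)-v(y)|^2}{|x-y|^{d+2s}}\,dx\,dy\Big)^{1/2}$, $\|v\|_{\mathbb{V}}=(\|v\|_{L^2(\Omega)}^2+|v|_{\mathbb{X}}^2)^{1/2}$, and $\mathbb{V}=\{v:\mathbb{R}^d\to\mathbb{R}\text{ measurable}:\|v\|_{\mathbb{V}}<\infty\}$. For $\gamma\in\mathbb{R}$, $\|v\|_{L^2_\gamma(\mathbb{R}^d)}=\Big(\int_{\mathbb{R}^d}\frac{|v(x)|^2}{1+|x|^{d+2\gamma}}\,dx\Big)^{1/2}$, and $L^2_\gamma(\mathbb{R}^d)$ is the space of measurable $v:\mathbb{R}^d\to\mathbb{R}$ for which this is finite. *)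

theory Defs
  imports "HOL-Analysis.Analysis"
begin

text \<open>
  The Euclidean space \<open>\<real>\<^sup>d\<close> is a type \<open>'a :: euclidean_space\<close> with \<open>d = DIM('a)\<close>.  Functions are
  honest (everywhere defined) Lebesgue measurable functions; as usual, functions that agree almost
  everywhere are not distinguished by the (extended) norms below.
\<close>

text \<open>
  Near each boundary point the set is the strict epigraph of a Lipschitz function \<open>\<psi>\<close> in some
  orthonormal coordinate system.  The vertical axis of that system is the unit vector \<open>e\<close>, and
  \<open>x - (x \<bullet> e) *\<^sub>R e\<close> is the horizontal part of \<open>x\<close>, lying in the hyperplane orthogonal to \<open>e\<close>.
\<close>

definition lipschitz_boundary :: "'a::euclidean_space set \<Rightarrow> bool" where
  "lipschitz_boundary \<Omega> \<longleftrightarrow>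
     (\<forall>z\<in>frontier \<Omega>. \<exists>r e \<psi> L. 0 < r \<and> norm e = 1 \<and>
        L-lipschitz_on {y. y \<bullet> e = 0} (\<psi> :: 'a \<Rightarrow> real) \<and>
        \<Omega> \<inter> ball z r = {x \<in> ball z r. \<psi> (x - (x \<bullet> e) *\<^sub>R e) < x \<bullet> e})"

definition bounded_lipschitz_domain :: "'a::euclidean_space set \<Rightarrow> bool" where
  "bounded_lipschitz_domain \<Omega> \<longleftrightarrow>
     open \<Omega> \<and> connected \<Omega> \<and> \<Omega> \<noteq> {} \<and> bounded \<Omega> \<and> lipschitz_boundary \<Omega>"

text \<open>Norms take values in \<open>[0,\<infinity>]\<close>, so that function spaces can be defined by finiteness.\<close>

definition ennreal_sqrt :: "ennreal \<Rightarrow> ennreal" where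
  "ennreal_sqrt x = (if x = \<infinity> then \<infinity> else ennreal (sqrt (enn2real x)))"

definition frac_const :: "nat \<Rightarrow> real \<Rightarrow> real" where
  "frac_const d s =
     2 powr (2 * s) * s * Gamma (s + real d / 2) / (pi powr (real d / 2) * Gamma (1 - s))"

definition ext_complement :: "'a::euclidean_space set \<Rightarrow> 'a set" where
  "ext_complement \<Omega> = - closure \<Omega>"

definition L2_norm :: "'a::euclidean_space set \<Rightarrow> ('a \<Rightarrow> real) \<Rightarrow> ennreal" where
  "L2_norm \<Omega> v = ennreal_sqrt (\<integral>\<^sup>+x\<in>\<Omega>. ennreal (\<bar>v x\<bar>\<^sup>2) \<partial>lebesgue)"

text \<open>
  On the diagonal the integrand is \<open>0 / 0 = 0\<close>; the diagonal is a null set, so this is harmless.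
\<close>

definition X_seminorm :: "'a::euclidean_space set \<Rightarrow> real \<Rightarrow> ('a \<Rightarrow> real) \<Rightarrow> ennreal" where
  "X_seminorm \<Omega> s v = ennreal_sqrt (ennreal (frac_const DIM('a) s / 2) *
     (\<integral>\<^sup>+p\<in>UNIV - ext_complement \<Omega> \<times> ext_complement \<Omega>.
        ennreal (\<bar>v (fst p) - v (snd p)\<bar>\<^sup>2 / norm (fst p - snd p) powr (real DIM('a) + 2 * s))
        \<partial>(lebesgue \<Otimes>\<^sub>M lebesgue)))"

definition V_norm :: "'a::euclidean_space set \<Rightarrow> real \<Rightarrow> ('a \<Rightarrow> real) \<Rightarrow> ennreal" where
  "V_norm \<Omega> s v = ennreal_sqrt ((L2_norm \<Omega> v)\<^sup>2 + (X_seminorm \<Omega> s v)\<^sup>2)"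

definition V_space :: "'a::euclidean_space set \<Rightarrow> real \<Rightarrow> ('a \<Rightarrow> real) set" where
  "V_space \<Omega> s = {v \<in> borel_measurable lebesgue. V_norm \<Omega> s v < \<infinity>}"

definition L2w_norm :: "real \<Rightarrow> ('a::euclidean_space \<Rightarrow> real) \<Rightarrow> ennreal" where
  "L2w_norm \<gamma> v = ennreal_sqrt
     (\<integral>\<^sup>+x. ennreal (\<bar>v x\<bar>\<^sup>2 / (1 + norm x powr (real DIM('a) + 2 * \<gamma>))) \<partial>lebesgue)"

definition L2w_space :: "real \<Rightarrow> ('a::euclidean_space \<Rightarrow> real) set" where
  "L2w_space \<gamma> = {v \<in> borel_measurable lebesgue. L2w_norm \<gamma> v < \<infinity>}"

text \<open>
  \<open>X\<close> with norm \<open>N\<close> is contained in \<open>Y\<close> with norm \<open>M\<close>, and the inclusion map is continuous.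
\<close>

definition continuously_embedded ::
  "('a \<Rightarrow> real) set \<Rightarrow> (('a \<Rightarrow> real) \<Rightarrow> ennreal) \<Rightarrow>
   ('a \<Rightarrow> real) set \<Rightarrow> (('a \<Rightarrow> real) \<Rightarrow> ennreal) \<Rightarrow> bool" where
  "continuously_embedded X N Y M \<longleftrightarrow> X \<subseteq> Y \<and>
     (\<forall>v\<in>X. \<forall>\<epsilon>::real. \<epsilon> > 0 \<longrightarrow> (\<exists>\<delta>::real. \<delta> > 0 \<and>
        (\<forall>w\<in>X. N (\<lambda>x. w x - v x) < ennreal \<delta> \<longrightarrow> M (\<lambda>x. w x - v x) < ennreal \<epsilon>)))"

end

theory Submission
  imports Defs
begin

text \<open>
  For \<open>x \<in> \<real>\<^sup>d\<close> and \<open>y \<in> \<Omega>\<close> write \<open>v x = v y + (v x - v y)\<close>, so that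
  \<open>(v x)\<^sup>2 \<le> 2 (v y)\<^sup>2 + 2 (v x - v y)\<^sup>2\<close>.  Multiply by the weight \<open>w x = 1 / (1 + |x|^(d + 2\<gamma>))\<close>
  and integrate over \<open>\<real>\<^sup>d \<times> \<Omega>\<close>.  The left side becomes \<open>|\<Omega>|\<close> times the square of the weighted
  norm.  The first term on the right becomes \<open>2 (\<integral>w) (\<integral>\<^bsub>\<Omega>\<^esub> v\<^sup>2)\<close>, and \<open>\<integral>w\<close> is finite because
  \<open>\<gamma> > 0\<close> (\<open>nn_integral_power_weight_finite\<close>).  For the second, the boundedness of \<open>\<Omega>\<close>
  and \<open>s \<le> \<gamma>\<close> give \<open>w x \<le> K / |x - y|^(d + 2s)\<close> for every \<open>y \<in> \<Omega> - {x}\<close>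
  (\<open>norm_diff_powr_le_weight\<close>), and \<open>\<real>\<^sup>d \<times> \<Omega>\<close> is contained in the domain of
  integration of the seminorm; so it is controlled by the energy of \<open>v\<close>.

  The integration step holds on any sigma-finite measure space and is isolated in
  \<open>weighted_L2_le_local_L2_plus_differences\<close>; \<open>L2w_norm_le_V_norm\<close> puts the pieces together for
  an arbitrary nonempty bounded open set.  Continuity of the embedding then follows
  by applying the norm bound to differences \<open>w - v\<close>.
\<close>

section \<open>Extended square roots, Lebesgue measure and the normalising constant\<close>

lemma ennreal_sqrt_power2 [simp]: "(ennreal_sqrt x)\<^sup>2 = x"
proof (cases x)
  case (real r)
  then show ?thesis
    by (simp add: ennreal_sqrt_def ennreal_power)
qed (simp add: ennreal_sqrt_def power2_eq_square)

lemma ennreal_sqrt_le_iff: "ennreal_sqrt x \<le> y \<longleftrightarrow> x \<le> y\<^sup>2"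
proof
  assume "ennreal_sqrt x \<le> y"
  then have "(ennreal_sqrt x)\<^sup>2 \<le> y\<^sup>2"
    by (intro power_mono) auto
  then show "x \<le> y\<^sup>2"
    by simp
next
  assume le: "x \<le> y\<^sup>2"
  show "ennreal_sqrt x \<le> y"
  proof (cases y)
    case (real b)
    with le obtain a where "x = ennreal a" "0 \<le> a" "a \<le> b\<^sup>2"
      by (cases x) (auto simp: ennreal_power power2_eq_square top_unique simp flip: ennreal_mult)
    with real show ?thesis
      by (simp add: ennreal_sqrt_def real_le_lsqrt)
  qed simp
qed

text \<open>
  Tonelli's theorem is applied on \<open>lebesgue \<Otimes>\<^sub>M lebesgue\<close>, a product of completed measures.  Completion
  does not change the measure of Borel sets, so an exhaustion for \<open>lborel\<close> still works.
\<close>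

lemma sigma_finite_lebesgue: "sigma_finite_measure (lebesgue :: 'a::euclidean_space measure)"
proof
  obtain A :: "'a set set" where A: "countable A" "A \<subseteq> sets lborel" "\<Union>A = space lborel"
      "\<forall>a\<in>A. emeasure lborel a \<noteq> \<infinity>"
    using lborel.sigma_finite_countable by blast
  moreover from A(2,4) have "\<forall>a\<in>A. emeasure lebesgue a \<noteq> \<infinity>"
    by (auto simp: emeasure_completion main_part_sets null_part_sets)
  ultimately show "\<exists>A. countable A \<and> A \<subseteq> sets lebesgue \<and> \<Union>A = space lebesgue \<and>
      (\<forall>a\<in>A. emeasure (lebesgue :: 'a measure) a \<noteq> \<infinity>)"
    by (intro exI[of _ A]) auto
qed

lemma frac_const_pos:
  assumes "0 < s" "s < 1"
  shows "0 < frac_const d s"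
  using assms by (auto simp: frac_const_def intro!: divide_pos_pos mult_pos_pos add_pos_nonneg)

section \<open>Bounds for the weight\<close>

text \<open>
  The weight decays like \<open>|x|^(-q)\<close>, so on a dyadic annulus it is comparable with a constant
  multiple of the indicator of the outer ball.  Summing these indicators reduces the
  integrability of the weight to a geometric series, without polar coordinates.
\<close>

lemma dyadic_ball_weight_bound:
  fixes x :: "'a::real_normed_vector"
  assumes "0 < q"
  shows "\<exists>k. 1 / (1 + norm x powr q) \<le> 2 powr q * (2 powr (- q)) ^ k * indicator (cball 0 (2 ^ k)) x"
proof -
  \<comment> \<open>By minimality \<open>|x| > 2^(k - 1)\<close> when \<open>k > 0\<close>; the factor \<open>2 powr q\<close> pays for the shift by one.\<close>
  define k where "k = (LEAST k. norm x \<le> 2 ^ k)"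
  have "\<exists>k. norm x \<le> 2 ^ k"
    using real_arch_pow[of 2 "norm x"] by (auto intro: less_imp_le)
  then have k: "norm x \<le> 2 ^ k"
    unfolding k_def by (rule LeastI_ex)
  have "1 / (1 + norm x powr q) \<le> 2 powr q * (2 powr (- q)) ^ k"
  proof (cases k)
    case 0
    have "1 / (1 + norm x powr q) \<le> 1"
      using powr_ge_zero[of "norm x" q] by (subst divide_le_eq_1_pos) linarith+
    also have "1 \<le> 2 powr q"
      using assms by (simp add: ge_one_powr_ge_zero)
    finally show ?thesis
      using 0 by simp
  next
    case (Suc j)
    then have "\<not> norm x \<le> 2 ^ j"
      using not_less_Least[of j "\<lambda>k. norm x \<le> 2 ^ k"] by (auto simp: k_def)
    then have "(2 ^ j) powr q \<le> norm x powr q"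
      using assms by (intro powr_mono2) auto
    then have "1 / (1 + norm x powr q) \<le> 1 / (2 ^ j) powr q"
      by (intro divide_left_mono mult_pos_pos) (auto simp: add_pos_nonneg)
    also have "\<dots> = 2 powr q * (2 powr (- q)) ^ k"
    proof -
      have "(2 ^ j) powr q = (2 powr q) ^ j"
        by (simp add: powr_powr mult.commute flip: powr_realpow)
      then show ?thesis
        by (simp add: Suc powr_minus power_inverse divide_inverse)
    qed
    finally show ?thesis .
  qed
  with k show ?thesis
    by (intro exI[of _ k]) simp
qed

text \<open>
  The \<open>k\<close>-th dyadic ball has volume proportional to \<open>2^(k d)\<close> and carries the coefficient
  \<open>2^(-k q)\<close>, so the series has ratio \<open>2^(d - q)\<close>, which is below \<open>1\<close> exactly when \<open>q > d\<close>.
\<close>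

lemma nn_integral_power_weight_finite:
  assumes "real DIM('a::euclidean_space) < q"
  shows "(\<integral>\<^sup>+x. ennreal (1 / (1 + norm (x::'a) powr q)) \<partial>lebesgue) < \<infinity>"
proof -
  define d where "d = DIM('a)"
  have d: "real d < q" "0 < d" "0 < q"
    using assms DIM_positive[where 'a='a] by (auto simp: d_def intro: le_less_trans)
  define u where "u = unit_ball_vol (real d)"
  define r where "r = 2 powr (real d - q)"
  have u: "0 \<le> u" and r: "0 < r" "r < 1"
    using d powr_less_mono[of "real d - q" 0 2] by (auto simp: u_def r_def)
  define f :: "nat \<Rightarrow> 'a \<Rightarrow> real" where
    "f = (\<lambda>k x. 2 powr q * (2 powr (- q)) ^ k * indicator (cball 0 (2 ^ k)) x)"
  have f_meas [measurable]: "f k \<in> borel_measurable lborel" for k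
    unfolding f_def
    by (intro borel_measurable_times borel_measurable_const borel_measurable_indicator) simp
  have "(\<integral>\<^sup>+x. ennreal (1 / (1 + norm (x::'a) powr q)) \<partial>lebesgue)
      = (\<integral>\<^sup>+x. ennreal (1 / (1 + norm (x::'a) powr q)) \<partial>lborel)"
    by (rule nn_integral_completion)
  also have "\<dots> \<le> (\<integral>\<^sup>+x. (\<Sum>k. ennreal (f k x)) \<partial>lborel)"
  proof (rule nn_integral_mono)
    fix x :: 'a
    obtain k where "1 / (1 + norm x powr q) \<le> f k x"
      using dyadic_ball_weight_bound[OF d(3), of x] by (auto simp: f_def)
    then have "ennreal (1 / (1 + norm x powr q)) \<le> ennreal (f k x)"
      by (rule ennreal_leI)
    also have "\<dots> \<le> (\<Sum>k. ennreal (f k x))"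
      using sum_le_suminf[of "\<lambda>k. ennreal (f k x)" "{k}"] by auto
    finally show "ennreal (1 / (1 + norm x powr q)) \<le> (\<Sum>k. ennreal (f k x))" .
  qed
  also have "\<dots> = (\<Sum>k. \<integral>\<^sup>+x. ennreal (f k x) \<partial>lborel)"
    by (rule nn_integral_suminf) measurable
  also have "\<dots> = (\<Sum>k. ennreal (2 powr q * u * r ^ k))"
  proof (rule suminf_cong)
    fix k
    have "(\<integral>\<^sup>+x. ennreal (f k x) \<partial>lborel)
        = (\<integral>\<^sup>+x. ennreal (2 powr q * (2 powr (- q)) ^ k) * indicator (cball (0::'a) (2 ^ k)) x \<partial>lborel)"
      by (intro nn_integral_cong) (auto simp: f_def split: split_indicator)
    also have "\<dots> = ennreal (2 powr q * (2 powr (- q)) ^ k) * emeasure lborel (cball (0::'a) (2 ^ k))"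
      by (subst nn_integral_cmult_indicator) auto
    also have "\<dots> = ennreal (2 powr q * (2 powr (- q)) ^ k * (u * (2 ^ k) ^ d))"
      using u by (simp add: emeasure_cball u_def d_def flip: ennreal_mult)
    also have "2 powr q * (2 powr (- q)) ^ k * (u * (2 ^ k) ^ d) = 2 powr q * u * r ^ k"
    proof -
      have "r ^ k = (2 powr (- q) * 2 ^ d) ^ k"
        by (simp add: r_def powr_realpow powr_diff powr_minus divide_inverse mult.commute)
      also have "\<dots> = (2 powr (- q)) ^ k * (2 ^ k) ^ d"
        by (simp add: power_mult_distrib mult.commute flip: power_mult)
      finally show ?thesis
        by simp
    qed
    finally show "(\<integral>\<^sup>+x. ennreal (f k x) \<partial>lborel) = ennreal (2 powr q * u * r ^ k)" .
  qed
  also have "\<dots> < \<infinity>"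
  proof -
    have "summable (\<lambda>k. 2 powr q * u * r ^ k)"
      using r by (intro summable_mult summable_geometric) auto
    with u r show ?thesis
      by (subst suminf_ennreal2) auto
  qed
  finally show ?thesis .
qed

text \<open>
  From a bounded set the distance to \<open>x\<close> grows at most linearly in \<open>max |x| 1\<close>.  Cutting off at \<open>1\<close>
  is what makes raising the exponent from \<open>p\<close> to \<open>q\<close> legitimate.
\<close>

lemma norm_diff_powr_le_weight:
  fixes x y :: "'a::real_normed_vector"
  assumes "0 \<le> p" "p \<le> q" "norm y \<le> R" "1 \<le> R"
  shows "norm (x - y) powr p \<le> (2 * R) powr p * (1 + norm x powr q)"
proof -
  define n where "n = max (norm x) 1"
  have "norm (x - y) \<le> norm x + R"
    using norm_triangle_ineq4[of x y] assms(3) by linarith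
  also have "\<dots> \<le> R * n + R * n"
    using assms(4) mult_mono[of 1 R "norm x" n] mult_mono[of R R 1 n]
    by (intro add_mono) (auto simp: n_def)
  finally have "norm (x - y) powr p \<le> (2 * R * n) powr p"
    using assms(1) by (intro powr_mono2) auto
  also have "\<dots> = (2 * R) powr p * n powr p"
    using assms(4) by (intro powr_mult)
  also have "n powr p \<le> n powr q"
    using assms(2) by (intro powr_mono) (auto simp: n_def)
  also have "n powr q \<le> 1 + norm x powr q"
    by (auto simp: n_def max_def)
  finally show ?thesis
    using mult_left_mono by fastforce
qed

section \<open>Comparison with local values\<close>

text \<open>
  The values of \<open>v\<close> on all of the space are recovered from those on \<open>B\<close> by averaging
  \<open>(v x)\<^sup>2 \<le> 2 (v y)\<^sup>2 + 2 (v x - v y)\<^sup>2\<close> over \<open>y \<in> B\<close>; the kernel \<open>h\<close> only has to dominate the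
  weighted squared differences with one point in \<open>B\<close>.
\<close>

lemma (in sigma_finite_measure) weighted_L2_le_local_L2_plus_differences:
  fixes v w :: "'a \<Rightarrow> real" and h :: "'a \<times> 'a \<Rightarrow> real"
  assumes [measurable]: "v \<in> borel_measurable M" "w \<in> borel_measurable M" "h \<in> borel_measurable (M \<Otimes>\<^sub>M M)"
    "B \<in> sets M"
    and "\<And>x. 0 \<le> w x" "\<And>p. 0 \<le> h p" "0 \<le> K"
    and le: "\<And>x y. x \<in> space M \<Longrightarrow> y \<in> B \<Longrightarrow> w x * (v x - v y)\<^sup>2 \<le> K * h (x, y)"
  shows "emeasure M B * (\<integral>\<^sup>+x. ennreal ((v x)\<^sup>2 * w x) \<partial>M)
    \<le> 2 * (\<integral>\<^sup>+x. ennreal (w x) \<partial>M) * (\<integral>\<^sup>+y\<in>B. ennreal ((v y)\<^sup>2) \<partial>M)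
      + ennreal (2 * K) * (\<integral>\<^sup>+p\<in>space M \<times> B. ennreal (h p) \<partial>(M \<Otimes>\<^sub>M M))"
proof -
  have pointwise: "ennreal ((v x)\<^sup>2 * w x) * indicator B y
      \<le> ennreal (2 * w x) * (ennreal ((v y)\<^sup>2) * indicator B y)
        + ennreal (2 * K) * (ennreal (h (x, y)) * indicator (space M \<times> B) (x, y))"
    if x: "x \<in> space M" for x y
  proof (cases "y \<in> B")
    case True
    \<comment> \<open>Right side minus left side is \<open>(v x - 2 v y)\<^sup>2\<close>.\<close>
    have "(v x)\<^sup>2 \<le> 2 * (v y)\<^sup>2 + 2 * (v x - v y)\<^sup>2"
      using zero_le_power2[of "v x - 2 * v y"] by (simp add: power2_eq_square algebra_simps)
    then have "(v x)\<^sup>2 * w x \<le> (2 * (v y)\<^sup>2 + 2 * (v x - v y)\<^sup>2) * w x"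
      using assms(5) by (intro mult_right_mono) auto
    also have "\<dots> = 2 * w x * (v y)\<^sup>2 + 2 * (w x * (v x - v y)\<^sup>2)"
      by (simp add: algebra_simps)
    also have "\<dots> \<le> 2 * w x * (v y)\<^sup>2 + 2 * K * h (x, y)"
      using le[OF x True] by simp
    finally show ?thesis
      using True x assms(5-7) by (simp add: ennreal_leI flip: ennreal_mult ennreal_plus)
  qed simp
  have "emeasure M B * (\<integral>\<^sup>+x. ennreal ((v x)\<^sup>2 * w x) \<partial>M)
      = (\<integral>\<^sup>+x. \<integral>\<^sup>+y. ennreal ((v x)\<^sup>2 * w x) * indicator B y \<partial>M \<partial>M)"
    by (simp add: nn_integral_cmult_indicator nn_integral_multc nn_integral_cmult mult.commute[of _ "emeasure M B"])
  also have "\<dots> \<le> (\<integral>\<^sup>+x. \<integral>\<^sup>+y. ennreal (2 * w x) * (ennreal ((v y)\<^sup>2) * indicator B y)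
        + ennreal (2 * K) * (ennreal (h (x, y)) * indicator (space M \<times> B) (x, y)) \<partial>M \<partial>M)"
    by (intro nn_integral_mono pointwise)
  also have "\<dots> = (\<integral>\<^sup>+x. ennreal (2 * w x) * (\<integral>\<^sup>+y\<in>B. ennreal ((v y)\<^sup>2) \<partial>M)
        + ennreal (2 * K) * (\<integral>\<^sup>+y. ennreal (h (x, y)) * indicator (space M \<times> B) (x, y) \<partial>M) \<partial>M)"
    by (intro nn_integral_cong) (simp add: nn_integral_add nn_integral_cmult)
  also have "\<dots> = (\<integral>\<^sup>+x. ennreal (2 * w x) \<partial>M) * (\<integral>\<^sup>+y\<in>B. ennreal ((v y)\<^sup>2) \<partial>M)
        + ennreal (2 * K) * (\<integral>\<^sup>+x. \<integral>\<^sup>+y. ennreal (h (x, y)) * indicator (space M \<times> B) (x, y) \<partial>M \<partial>M)"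
    by (simp add: nn_integral_add nn_integral_cmult nn_integral_multc)
  also have "(\<integral>\<^sup>+x. \<integral>\<^sup>+y. ennreal (h (x, y)) * indicator (space M \<times> B) (x, y) \<partial>M \<partial>M)
      = (\<integral>\<^sup>+p\<in>space M \<times> B. ennreal (h p) \<partial>(M \<Otimes>\<^sub>M M))"
    by (rule nn_integral_fst) measurable
  also have "(\<integral>\<^sup>+x. ennreal (2 * w x) \<partial>M) = 2 * (\<integral>\<^sup>+x. ennreal (w x) \<partial>M)"
    using assms(5) by (simp add: ennreal_mult nn_integral_cmult)
  finally show ?thesis .
qed

section \<open>The embedding\<close>

lemma V_norm_power2:
  "(V_norm \<Omega> s v)\<^sup>2 = (\<integral>\<^sup>+x\<in>\<Omega>. ennreal (\<bar>v x\<bar>\<^sup>2) \<partial>lebesgue) +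
    ennreal (frac_const DIM('a) s / 2) *
     (\<integral>\<^sup>+p\<in>UNIV - ext_complement \<Omega> \<times> ext_complement \<Omega>.
        ennreal (\<bar>v (fst p) - v (snd p)\<bar>\<^sup>2 / norm (fst p - snd p) powr (real DIM('a) + 2 * s))
        \<partial>(lebesgue \<Otimes>\<^sub>M lebesgue))"
  for \<Omega> :: "'a::euclidean_space set"
  by (simp add: V_norm_def L2_norm_def X_seminorm_def)

text \<open>
  Positive finite measure of \<open>\<Omega>\<close> allows dividing by it after the averaging; boundedness also gives
  the domination of the weight by the singular kernel.
\<close>

lemma L2w_norm_le_V_norm:
  fixes \<Omega> :: "'a::euclidean_space set"
  assumes "open \<Omega>" "bounded \<Omega>" "\<Omega> \<noteq> {}" "0 < s" "s < 1" "s \<le> \<gamma>"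
  shows "\<exists>C>0. \<forall>v\<in>borel_measurable lebesgue. L2w_norm \<gamma> v \<le> ennreal C * V_norm \<Omega> s v"
proof -
  interpret sigma_finite_measure "lebesgue :: 'a measure"
    by (rule sigma_finite_lebesgue)
  define p where "p = real DIM('a) + 2 * s"
  define q where "q = real DIM('a) + 2 * \<gamma>"
  define k where "k = frac_const DIM('a) s / 2"
  define w :: "'a \<Rightarrow> real" where "w = (\<lambda>x. 1 / (1 + norm x powr q))"
  have pq: "0 \<le> p" "p \<le> q" "real DIM('a) < q" and k: "0 < k"
    using assms frac_const_pos by (auto simp: p_def q_def k_def)
  obtain R where R: "1 \<le> R" "\<And>y. y \<in> \<Omega> \<Longrightarrow> norm y \<le> R"
    using assms(2) unfolding bounded_iff by (metis max.cobounded1 max.coboundedI2)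
  define K where "K = (2 * R) powr p"
  have K: "0 < K"
    using R(1) by (simp add: K_def)
  have w_pos: "0 < w x" for x
    by (simp add: w_def add_pos_nonneg)
  have id_meas [measurable]: "(\<lambda>x::'a. x) \<in> measurable lebesgue borel"
    using id_borel_measurable_lebesgue by (simp add: id_def)
  have w_meas [measurable]: "w \<in> borel_measurable lebesgue"
    unfolding w_def by measurable
  have [measurable]: "\<Omega> \<in> sets lebesgue"
    using assms(1) by (simp add: lmeasurable_open)
  define W where "W = enn2real (\<integral>\<^sup>+x. ennreal (w x) \<partial>lebesgue)"
  have W: "(\<integral>\<^sup>+x. ennreal (w x) \<partial>lebesgue) = ennreal W" "0 \<le> W"
    using nn_integral_power_weight_finite[OF pq(3)] by (auto simp: W_def w_def)
  define m where "m = measure lebesgue \<Omega>"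
  have fin: "\<Omega> \<in> lmeasurable"
    using assms by (intro lmeasurable_open)
  have m: "emeasure lebesgue \<Omega> = ennreal m" "0 < m"
    using fin open_not_negligible[OF assms(1,3)]
    by (auto simp: m_def emeasure_eq_measure2 fmeasurableD2 zero_less_measure_iff negligible_iff_measure0 emeasure_eq_ennreal_measure top.not_eq_extremum)
  \<comment> \<open>\<open>m c\<close> dominates \<open>2 W\<close>, the coefficient of the local \<open>L\<^sup>2\<close> term, and \<open>m c k\<close> dominates \<open>2 K\<close>,
    that of the energy, so \<open>c\<close> bounds the squared norm.\<close>
  define c where "c = 2 * W / m + 2 * K / (m * k)"
  have c: "0 < c" "2 * W \<le> m * c" "2 * K \<le> m * c * k"
    using K k m(2) W(2) by (auto simp: c_def field_simps add_pos_nonneg)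
  have "L2w_norm \<gamma> v \<le> ennreal (sqrt c) * V_norm \<Omega> s v" if v [measurable]: "v \<in> borel_measurable lebesgue" for v
  proof -
    define h where "h = (\<lambda>z. \<bar>v (fst z) - v (snd z)\<bar>\<^sup>2 / norm (fst z - snd z) powr p)"
    define A where "A = (\<integral>\<^sup>+x\<in>\<Omega>. ennreal (\<bar>v x\<bar>\<^sup>2) \<partial>lebesgue)"
    define I where "I = (\<integral>\<^sup>+x. ennreal (\<bar>v x\<bar>\<^sup>2 / (1 + norm x powr q)) \<partial>lebesgue)"
    define D where "D = (\<integral>\<^sup>+z\<in>UNIV - ext_complement \<Omega> \<times> ext_complement \<Omega>. ennreal (h z) \<partial>(lebesgue \<Otimes>\<^sub>M lebesgue))"
    have kernel: "w x * (v x - v y)\<^sup>2 \<le> K * h (x, y)" if "y \<in> \<Omega>" for x y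
    \<comment> \<open>On the diagonal the singular kernel is \<open>0 / 0 = 0\<close>, and so is the difference.\<close>
    proof (cases "x = y")
      case False
      then have "0 < norm (x - y) powr p"
        by simp
      moreover have "norm (x - y) powr p * w x \<le> K"
        using norm_diff_powr_le_weight[OF pq(1,2) R(2)[OF that] R(1), of x]
        by (simp add: w_def K_def divide_simps add_pos_nonneg)
      ultimately have "w x \<le> K / norm (x - y) powr p"
        by (simp add: field_simps)
      then have "w x * (v x - v y)\<^sup>2 \<le> K / norm (x - y) powr p * (v x - v y)\<^sup>2"
        by (rule mult_right_mono) simp
      then show ?thesis
        by (simp add: h_def)
    qed (simp add: h_def)
    have "ennreal m * I \<le> 2 * ennreal W * A
        + ennreal (2 * K) * (\<integral>\<^sup>+z\<in>space lebesgue \<times> \<Omega>. ennreal (h z) \<partial>(lebesgue \<Otimes>\<^sub>M lebesgue))"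
    proof -
      have "h \<in> borel_measurable (lebesgue \<Otimes>\<^sub>M lebesgue)"
        unfolding h_def by measurable
      from weighted_L2_le_local_L2_plus_differences[OF v w_meas this, of \<Omega> K]
      show ?thesis
        using kernel K w_pos by (simp add: less_imp_le h_def W(1)[unfolded w_def] m(1) A_def I_def w_def)
    qed
    also have "\<dots> \<le> 2 * ennreal W * A + ennreal (2 * K) * D"
      unfolding D_def ext_complement_def using closure_subset[of \<Omega>]
      by (intro add_left_mono mult_left_mono nn_integral_mono) (auto split: split_indicator)
    also have "2 * ennreal W = ennreal (2 * W)"
      using W(2) by (simp add: ennreal_mult)
    also have "ennreal (2 * W) * A + ennreal (2 * K) * D \<le> ennreal (m * c) * A + ennreal (m * c * k) * D"
      using c by (intro add_mono mult_right_mono ennreal_leI) auto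
    also have "\<dots> = ennreal m * (ennreal c * (A + ennreal k * D))"
      using c(1) m(2) k by (simp add: ennreal_mult algebra_simps)
    finally have "I \<le> ennreal c * (A + ennreal k * D)"
      using m(2) by (simp add: ennreal_mult_le_mult_iff)
    also have "ennreal c = (ennreal (sqrt c))\<^sup>2"
      using c(1) by (simp add: ennreal_power)
    also have "A + ennreal k * D = (V_norm \<Omega> s v)\<^sup>2"
      by (simp add: V_norm_power2 A_def D_def h_def k_def p_def)
    finally show ?thesis
      by (simp add: L2w_norm_def ennreal_sqrt_le_iff I_def q_def power_mult_distrib)
  qed
  with c(1) show ?thesis
    by (intro exI[of _ "sqrt c"]) auto
qed

theorem proposition2p1:
  fixes \<Omega> :: "'a::euclidean_space set" and s \<gamma> :: real
  assumes "bounded_lipschitz_domain \<Omega>"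
    and "0 < s" and "s < 1" and "s \<le> \<gamma>"
  shows "(\<exists>C::real. C > 0 \<and> (\<forall>v\<in>V_space \<Omega> s. L2w_norm \<gamma> v \<le> ennreal C * V_norm \<Omega> s v)) \<and>
         continuously_embedded (V_space \<Omega> s) (V_norm \<Omega> s) (L2w_space \<gamma>) (L2w_norm \<gamma>)"
proof -
  obtain C where "C > 0"
    and C: "\<And>v. v \<in> borel_measurable lebesgue \<Longrightarrow> L2w_norm \<gamma> v \<le> ennreal C * V_norm \<Omega> s v"
    using L2w_norm_le_V_norm[of \<Omega> s \<gamma>] assms by (auto simp: bounded_lipschitz_domain_def)
  have "V_space \<Omega> s \<subseteq> L2w_space \<gamma>"
  proof
    fix v assume "v \<in> V_space \<Omega> s"
    then have v: "v \<in> borel_measurable lebesgue" "V_norm \<Omega> s v < \<infinity>"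
      by (auto simp: V_space_def)
    have "ennreal C * V_norm \<Omega> s v < \<infinity>"
      using v(2) by (simp add: ennreal_mult_less_top)
    with C[OF v(1)] v(1) show "v \<in> L2w_space \<gamma>"
      by (auto simp: L2w_space_def intro: le_less_trans)
  qed
  moreover have "\<exists>\<delta>::real. \<delta> > 0 \<and> (\<forall>w\<in>V_space \<Omega> s. V_norm \<Omega> s (\<lambda>x. w x - v x) < ennreal \<delta> \<longrightarrow>
      L2w_norm \<gamma> (\<lambda>x. w x - v x) < ennreal \<epsilon>)"
    if v: "v \<in> V_space \<Omega> s" and "\<epsilon> > 0" for v and \<epsilon> :: real
  \<comment> \<open>Half of \<open>\<epsilon> / C\<close> keeps the final inequality strict.\<close>
  proof (intro exI[of _ "\<epsilon> / (2 * C)"] conjI ballI impI)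
    fix w assume w: "w \<in> V_space \<Omega> s" and less: "V_norm \<Omega> s (\<lambda>x. w x - v x) < ennreal (\<epsilon> / (2 * C))"
    have "L2w_norm \<gamma> (\<lambda>x. w x - v x) \<le> ennreal C * V_norm \<Omega> s (\<lambda>x. w x - v x)"
      using v w by (intro C) (auto simp: V_space_def)
    also have "\<dots> \<le> ennreal C * ennreal (\<epsilon> / (2 * C))"
      using less by (intro mult_left_mono) auto
    also have "\<dots> = ennreal (\<epsilon> / 2)"
      using \<open>C > 0\<close> \<open>\<epsilon> > 0\<close> by (simp flip: ennreal_mult)
    also have "\<dots> < ennreal \<epsilon>"
      using \<open>\<epsilon> > 0\<close> by (intro ennreal_lessI) auto
    finally show "L2w_norm \<gamma> (\<lambda>x. w x - v x) < ennreal \<epsilon>" .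
  qed (use \<open>C > 0\<close> \<open>\<epsilon> > 0\<close> in simp)
  ultimately show ?thesis
    using \<open>C > 0\<close> C by (auto simp: continuously_embedded_def V_space_def)
qed

end
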